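(* Let $\mathcal{P}=(N,\mathit{Var},\mathit{Act},\lambda,\mathtt{succ},r)$ be a predicate decision diagram (PDD) over $\mathit{Var}$ and $\mathbb{D}$ with set of decision nodes $D$, and let $\pi$ be a total order on its set of predicates $\lambda(D)$. Then there is a PDD $\mathcal{P}'$ over $\mathit{Var}$ and $\mathbb{D}$ that is consistent, reduced, ordered with respect to $\pi$, and semantically equivalent to $\mathcal{P}$ (i.e. $[\![\mathcal{P}']\!](\epsilon)=[\![\mathcal{P}]\!](\epsilon)$ for all evaluations $\epsilon\colon\mathit{Var}\to\mathbb{D}$), and that is represented by a predicate consistent BDD: there are a set $\mathit{PVar}$ of Boolean variables, a bijection $\gamma\colon\mathit{PVar}\to\lambda(D)$, and a $(\pi\circ\gamma)$-BDD $\mathcal{B}$ over $\mathit{PVar}$ and $\mathit{Act}$ that is predicate consistent w.r.t. $\gamma$ such that $\mathcal{P}'=\gamma(\mathcal{B})$.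
   Context: **Evaluations and predicates.** $\mathit{Var}$ is a set of variables and $\mathbb{D}$ is a (nonempty, totally ordered) variable domain such as $\{0,1\},\mathbb{N},\mathbb{Q},\mathbb{R}$; $\mathbb{B}=\{0,1\}$. $\mathit{Act}$ is a set of actions. An evaluation is a function $\epsilon\colon\mathit{Var}\to\mathbb{D}$. A predicate over $\mathit{Var},\mathbb{D}$ is an expression $x\sim c$ with $x\in\mathit{Var}$, $c\in\mathbb{D}$, ${\sim}\in\{=,\geq,>\}$; $\epsilon\models(x\sim c)$ iff $\epsilon(x)\sim c$. The set of predicates is $\mathbb{P}(\mathit{Var},\mathbb{D})$. A total order over a finite set $X$ is a bijection $X\to\{1,\dots,|X|\}$. **PDD.** A PDD over $\mathit{Var}$ and $\mathbb{D}$ is a tuple $\mathcal{P}=(N,\mathit{Var},\mathit{Act},\lambda,\mathtt{succ},r)$ with $N$ a finite set of nodes, $D\subseteq N$ the decision nodes, $N\setminus D$ the action nodes, $\lambda$ labeling each node of $D$ by a predicate in $\mathbb{P}(\mathit{Var},\mathbb{D})$ and each node of $N\setminus D$ by a subset of $\mathit{Act}$, $\mathtt{succ}\colon D\times\mathbb{B}\to N$, and $r\in N$ the root. The directed graph with edges $d\to\mathtt{succ}(d,b)$ is acyclic. $\mathcal{P}_n$ denotes the sub-PDD consisting of the nodes reachable from $n$, with root $n$. **Semantics.** $[\![\mathcal{P}]\!]=[\![\mathcal{P}_r]\!]$, where $[\![\mathcal{P}_n]\!](\epsilon)=\lambda(n)$ if $n\in N\setminus D$; $=[\![\mathcal{P}_{\mathtt{succ}(n,1)}]\!](\epsilon)$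 if $n\in D$ and $\epsilon\models\lambda(n)$; $=[\![\mathcal{P}_{\mathtt{succ}(n,0)}]\!](\epsilon)$ if $n\in D$ and $\epsilon\not\models\lambda(n)$. **Properties of PDDs.** - Ordered w.r.t. a total order $\pi$ on a set of predicates containing all labels of decision nodes: for all $d\in D$, $b\in\mathbb{B}$ with $\mathtt{succ}(d,b)\in D$, $\pi(\lambda(d))<\pi(\lambda(\mathtt{succ}(d,b)))$. - Reduced: every decision node is essential ($\mathtt{succ}(d,0)\ne\mathtt{succ}(d,1)$) and there are no two distinct nodes $n\neq n'$ with $\mathcal{P}_n$ and $\mathcal{P}_{n'}$ isomorphic as labeled rooted diagrams. - A path is an alternating sequence $d_0,b_0,d_1,\dots,d_k\in(D\times\mathbb{B})^*\times N$ with $d_{i+1}=\mathtt{succ}(d_i,b_i)$ for $i<k$. A path ending in an action node is consistent with an evaluation $\epsilon$ if for all $i<k$: $\epsilon\models\lambda(d_i)$ iff $b_i=1$. - Consistent: for every path from the root to an action node there is an evaluation with which it is consistent. **BDD.** A $\pi'$-BDD over a finite set $\mathit{PVar}$ of Boolean variables and $\mathit{Act}$, for a total order $\pi'$ on $\mathit{PVar}$, is a (reduced ordered multi-terminal) binary decision diagram: a finite rooted diagram defined like a PDD, all of whose nodes are reachable from the root, except that decision nodes are labeled by variables in $\mathit{PVar}$; it is ordered with respect to $\pi'$ and reduced, in the same sense as for PDDs. Given a bijection $\gamma$ from $\mathit{PVar}$ to a set of predicates, $\gamma(\mathcal{B})$ is the PDD obtained from $\mathcal{B}$ by replacing the label $x$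 of each decision node by the predicate $\gamma(x)$. $\mathcal{B}$ is predicate consistent w.r.t. $\gamma$ if the PDD $\gamma(\mathcal{B})$ is consistent. *)

theory Defs
  imports Main "HOL-Library.FuncSet"
begin

text \<open>
  Variables and actions are carrier sets; the variable domain is a type of class
  \<^class>\<open>linorder\<close>, hence nonempty and totally ordered.
\<close>

datatype comparison = Equal | Geq | Greater

datatype ('v, 'd) predicate = Predicate 'v comparison 'd

definition predicates :: "'v set \<Rightarrow> ('v, 'd) predicate set" where
  "predicates Var = {Predicate x c d | x c d. x \<in> Var}"

definition evaluations :: "'v set \<Rightarrow> ('v \<Rightarrow> 'd) set" where
  "evaluations Var = Var \<rightarrow>\<^sub>E UNIV"

fun satisfies :: "('v \<Rightarrow> 'd::linorder) \<Rightarrow> ('v, 'd) predicate \<Rightarrow> bool" where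
  "satisfies \<epsilon> (Predicate x Equal c) \<longleftrightarrow> \<epsilon> x = c"
| "satisfies \<epsilon> (Predicate x Geq c) \<longleftrightarrow> \<epsilon> x \<ge> c"
| "satisfies \<epsilon> (Predicate x Greater c) \<longleftrightarrow> \<epsilon> x > c"

definition tot_order :: "'x set \<Rightarrow> ('x \<Rightarrow> nat) \<Rightarrow> bool" where
  "tot_order X \<pi> \<longleftrightarrow> finite X \<and> bij_betw \<pi> X {1..card X}"

text \<open>
  Diagrams are generic in the type of decision labels: predicates for PDDs, Boolean variables
  for BDDs.  As in the tuple notation, the set of decision nodes is not a separate component:
  it consists of the nodes with a label of the form \<^term>\<open>Inl l\<close>, while an action node
  has a label \<^term>\<open>Inr A\<close> with a set \<^term>\<open>A\<close> of actions.
\<close>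

record ('n, 'l, 'a) diagram =
  nodes :: "'n set"
  node_label :: "'n \<Rightarrow> 'l + 'a set"
  succ :: "'n \<Rightarrow> bool \<Rightarrow> 'n"
  root_node :: 'n

definition decision_nodes :: "('n, 'l, 'a) diagram \<Rightarrow> 'n set" where
  "decision_nodes P = {n \<in> nodes P. isl (node_label P n)}"

definition action_nodes :: "('n, 'l, 'a) diagram \<Rightarrow> 'n set" where
  "action_nodes P = nodes P - decision_nodes P"

definition decision_label :: "('n, 'l, 'a) diagram \<Rightarrow> 'n \<Rightarrow> 'l" where
  "decision_label P d = projl (node_label P d)"

definition action_label :: "('n, 'l, 'a) diagram \<Rightarrow> 'n \<Rightarrow> 'a set" where
  "action_label P n = projr (node_label P n)"

definition decision_labels :: "('n, 'l, 'a) diagram \<Rightarrow> 'l set" where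
  "decision_labels P = decision_label P ` decision_nodes P"

definition edges :: "('n, 'l, 'a) diagram \<Rightarrow> ('n \<times> 'n) set" where
  "edges P = {(d, succ P d b) | d b. d \<in> decision_nodes P}"

definition decision_diagram :: "'l set \<Rightarrow> 'a set \<Rightarrow> ('n, 'l, 'a) diagram \<Rightarrow> bool" where
  "decision_diagram L Act P \<longleftrightarrow>
     finite (nodes P) \<and>
     root_node P \<in> nodes P \<and>
     decision_labels P \<subseteq> L \<and>
     (\<forall>n \<in> action_nodes P. action_label P n \<subseteq> Act) \<and>
     (\<forall>d \<in> decision_nodes P. \<forall>b. succ P d b \<in> nodes P) \<and>
     acyclic (edges P)"

definition PDD :: "'v set \<Rightarrow> 'a set \<Rightarrow> ('n, ('v, 'd) predicate, 'a) diagram \<Rightarrow> bool" where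
  "PDD Var Act P \<longleftrightarrow> decision_diagram (predicates Var) Act P"

definition subdiagram :: "('n, 'l, 'a) diagram \<Rightarrow> 'n \<Rightarrow> ('n, 'l, 'a) diagram" where
  "subdiagram P n = P\<lparr>nodes := {m. (n, m) \<in> (edges P)\<^sup>*}, root_node := n\<rparr>"

text \<open>
  The recursion follows \<^const>\<open>succ\<close> and therefore terminates on acyclic finite diagrams;
  since it is tail recursive, the equation holds without side conditions.
  \<open>sem_node P n\<close> is the semantics of the subdiagram of \<open>P\<close> rooted at \<open>n\<close>.
\<close>

partial_function (tailrec) sem_node ::
  "('n, ('v, 'd::linorder) predicate, 'a) diagram \<Rightarrow> 'n \<Rightarrow> ('v \<Rightarrow> 'd) \<Rightarrow> 'a set" where
  "sem_node P n \<epsilon> =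
     (case node_label P n of
        Inr A \<Rightarrow> A
      | Inl p \<Rightarrow> sem_node P (succ P n (satisfies \<epsilon> p)) \<epsilon>)"

definition sem ::
  "('n, ('v, 'd::linorder) predicate, 'a) diagram \<Rightarrow> ('v \<Rightarrow> 'd) \<Rightarrow> 'a set" where
  "sem P \<epsilon> = sem_node P (root_node P) \<epsilon>"

definition ordered_diagram :: "'l set \<Rightarrow> ('l \<Rightarrow> nat) \<Rightarrow> ('n, 'l, 'a) diagram \<Rightarrow> bool" where
  "ordered_diagram X \<pi> P \<longleftrightarrow>
     tot_order X \<pi> \<and> decision_labels P \<subseteq> X \<and>
     (\<forall>d \<in> decision_nodes P. \<forall>b. succ P d b \<in> decision_nodes P \<longrightarrow>
        \<pi> (decision_label P d) < \<pi> (decision_label P (succ P d b)))"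

definition isomorphic_diagrams :: "('n, 'l, 'a) diagram \<Rightarrow> ('m, 'l, 'a) diagram \<Rightarrow> bool" where
  "isomorphic_diagrams P Q \<longleftrightarrow>
     (\<exists>f. bij_betw f (nodes P) (nodes Q) \<and>
          f (root_node P) = root_node Q \<and>
          (\<forall>n \<in> nodes P. node_label Q (f n) = node_label P n) \<and>
          (\<forall>d \<in> decision_nodes P. \<forall>b. succ Q (f d) b = f (succ P d b)))"

definition reduced_diagram :: "('n, 'l, 'a) diagram \<Rightarrow> bool" where
  "reduced_diagram P \<longleftrightarrow>
     (\<forall>d \<in> decision_nodes P. succ P d False \<noteq> succ P d True) \<and>
     (\<forall>n \<in> nodes P. \<forall>n' \<in> nodes P. n \<noteq> n' \<longrightarrow>
        \<not> isomorphic_diagrams (subdiagram P n) (subdiagram P n'))"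

text \<open>
  A path \<open>d\<^sub>0, b\<^sub>0, d\<^sub>1, \<dots>, d\<^sub>k\<close> is the pair of the list
  \<open>[(d\<^sub>0, b\<^sub>0), \<dots>, (d\<^sub>k\<^sub>-\<^sub>1, b\<^sub>k\<^sub>-\<^sub>1)]\<close> and the final node \<open>d\<^sub>k\<close>.
\<close>

type_synonym 'n path = "('n \<times> bool) list \<times> 'n"

definition path_nodes :: "'n path \<Rightarrow> 'n list" where
  "path_nodes p = map fst (fst p) @ [snd p]"

definition is_path :: "('n, 'l, 'a) diagram \<Rightarrow> 'n path \<Rightarrow> bool" where
  "is_path P p \<longleftrightarrow>
     set (fst p) \<subseteq> decision_nodes P \<times> UNIV \<and> snd p \<in> nodes P \<and>
     (\<forall>i < length (fst p).
        path_nodes p ! Suc i = succ P (path_nodes p ! i) (snd (fst p ! i)))"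

definition path_consistent_with ::
  "('n, ('v, 'd::linorder) predicate, 'a) diagram \<Rightarrow> 'n path \<Rightarrow> ('v \<Rightarrow> 'd) \<Rightarrow> bool" where
  "path_consistent_with P p \<epsilon> \<longleftrightarrow>
     (\<forall>i < length (fst p).
        satisfies \<epsilon> (decision_label P (path_nodes p ! i)) \<longleftrightarrow> snd (fst p ! i))"

definition consistent_PDD ::
  "'v set \<Rightarrow> ('n, ('v, 'd::linorder) predicate, 'a) diagram \<Rightarrow> bool" where
  "consistent_PDD Var P \<longleftrightarrow>
     (\<forall>p. is_path P p \<and> path_nodes p ! 0 = root_node P \<and> snd p \<in> action_nodes P \<longrightarrow>
        (\<exists>\<epsilon> \<in> evaluations Var. path_consistent_with P p \<epsilon>))"

definition BDD ::
  "'p set \<Rightarrow> ('p \<Rightarrow> nat) \<Rightarrow> 'a set \<Rightarrow> ('n, 'p, 'a) diagram \<Rightarrow> bool" where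
  "BDD PVar \<pi> Act B \<longleftrightarrow>
     decision_diagram PVar Act B \<and>
     (\<forall>n \<in> nodes B. (root_node B, n) \<in> (edges B)\<^sup>*) \<and>
     ordered_diagram PVar \<pi> B \<and>
     reduced_diagram B"

definition relabel :: "('p \<Rightarrow> 'l) \<Rightarrow> ('n, 'p, 'a) diagram \<Rightarrow> ('n, 'l, 'a) diagram" where
  "relabel \<gamma> B =
     \<lparr>nodes = nodes B, node_label = (\<lambda>n. map_sum \<gamma> id (node_label B n)),
      succ = succ B, root_node = root_node B\<rparr>"

definition predicate_consistent ::
  "'v set \<Rightarrow> ('p \<Rightarrow> ('v, 'd::linorder) predicate) \<Rightarrow> ('n, 'p, 'a) diagram \<Rightarrow> bool" where
  "predicate_consistent Var \<gamma> B \<longleftrightarrow> consistent_PDD Var (relabel \<gamma> B)"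

end

theory Submission
  imports Defs
begin

text \<open>
  Read the predicates in the order \<open>\<pi>\<close>, keeping track of the nonempty set \<open>E\<close> of evaluations
  that agree with the answers so far. A predicate that does not split \<open>E\<close> is skipped, and a
  decision whose two subtrees coincide is replaced by that subtree. In the resulting decision tree
  each branch is realised by an evaluation. Merging equal subtrees yields a reduced diagram whose
  paths from the root are still exactly the branches of the tree, hence consistent.
\<close>

section \<open>Decision trees\<close>

text \<open>In \<open>Node x l h\<close> the tree \<open>l\<close> (low) is taken when the test
  \<open>x\<close> fails and \<open>h\<close> (high) when it succeeds.\<close>

datatype ('l, 'a) dtree = Leaf "'a set" | Node 'l "('l, 'a) dtree" "('l, 'a) dtree"

primrec subtrees :: "('l, 'a) dtree \<Rightarrow> ('l, 'a) dtree set" where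
  "subtrees (Leaf A) = {Leaf A}"
| "subtrees (Node x l h) = insert (Node x l h) (subtrees l \<union> subtrees h)"

primrec tree_labels :: "('l, 'a) dtree \<Rightarrow> 'l set" where
  "tree_labels (Leaf A) = {}"
| "tree_labels (Node x l h) = insert x (tree_labels l \<union> tree_labels h)"

primrec leaf_sets :: "('l, 'a) dtree \<Rightarrow> 'a set set" where
  "leaf_sets (Leaf A) = {A}"
| "leaf_sets (Node x l h) = leaf_sets l \<union> leaf_sets h"

primrec branches :: "('l, 'a) dtree \<Rightarrow> ('l \<times> bool) list set" where
  "branches (Leaf A) = {[]}"
| "branches (Node x l h) = (#) (x, False) ` branches l \<union> (#) (x, True) ` branches h"

primrec tree_eval :: "('l \<Rightarrow> bool) \<Rightarrow> ('l, 'a) dtree \<Rightarrow> 'a set" where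
  "tree_eval v (Leaf A) = A"
| "tree_eval v (Node x l h) = (if v x then tree_eval v h else tree_eval v l)"

primrec reduced_tree :: "('l, 'a) dtree \<Rightarrow> bool" where
  "reduced_tree (Leaf A) \<longleftrightarrow> True"
| "reduced_tree (Node x l h) \<longleftrightarrow> l \<noteq> h \<and> reduced_tree l \<and> reduced_tree h"

text \<open>All labels below the root are compared with it, not just those of its children. The
  condition on single edges in \<open>ordered_diagram\<close> is then read off directly.\<close>

primrec ordered_tree :: "('l \<Rightarrow> nat) \<Rightarrow> ('l, 'a) dtree \<Rightarrow> bool" where
  "ordered_tree \<rho> (Leaf A) \<longleftrightarrow> True"
| "ordered_tree \<rho> (Node x l h) \<longleftrightarrow>
     (\<forall>y \<in> tree_labels l \<union> tree_labels h. \<rho> x < \<rho> y) \<and> ordered_tree \<rho> l \<and> ordered_tree \<rho> h"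

lemma finite_subtrees [simp]: "finite (subtrees t)"
  by (induction t) auto

lemma subtrees_refl [simp]: "t \<in> subtrees t"
  by (cases t) auto

lemma subtrees_trans: "s \<in> subtrees t \<Longrightarrow> t \<in> subtrees u \<Longrightarrow> s \<in> subtrees u"
  by (induction u) auto

lemma Node_subtreesD:
  assumes "Node x l h \<in> subtrees t"
  shows "l \<in> subtrees t" "h \<in> subtrees t"
  using subtrees_trans[OF _ assms] by auto

lemma tree_labels_subtree: "s \<in> subtrees t \<Longrightarrow> tree_labels s \<subseteq> tree_labels t"
  by (induction t) auto

lemma leaf_sets_subtree: "s \<in> subtrees t \<Longrightarrow> leaf_sets s \<subseteq> leaf_sets t"
  by (induction t) auto

lemma reduced_tree_subtree: "reduced_tree t \<Longrightarrow> s \<in> subtrees t \<Longrightarrow> reduced_tree s"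
  by (induction t) auto

lemma ordered_tree_subtree: "ordered_tree \<rho> t \<Longrightarrow> s \<in> subtrees t \<Longrightarrow> ordered_tree \<rho> s"
  by (induction t) auto


section \<open>Sharing the subtrees of a decision tree\<close>

text \<open>The nodes are codes of the subtrees, so equal subtrees occurring at different places
  become one node; \<open>inv_into\<close> decodes a node. The successor of a leaf is a dummy value,
  as edges leave decision nodes only.\<close>

definition tree_diagram ::
  "(('l, 'a) dtree \<Rightarrow> 'n) \<Rightarrow> ('l, 'a) dtree \<Rightarrow> ('n, 'l, 'a) diagram" where
  "tree_diagram enc T =
     \<lparr>nodes = enc ` subtrees T,
      node_label = (\<lambda>n. case inv_into (subtrees T) enc n of Leaf A \<Rightarrow> Inr A | Node x l h \<Rightarrow> Inl x),
      succ = (\<lambda>n b. case inv_into (subtrees T) enc n of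
                Leaf A \<Rightarrow> n | Node x l h \<Rightarrow> enc (if b then h else l)),
      root_node = enc T\<rparr>"

text \<open>Injectivity is asked on the subtrees of \<open>T\<close> only. They form a finite set,
  so codes in \<open>nat\<close> exist even when the type of all trees is uncountable.\<close>

locale shared_tree =
  fixes enc :: "('l, 'a) dtree \<Rightarrow> 'n" and T :: "('l, 'a) dtree"
  assumes inj: "inj_on enc (subtrees T)"
begin

abbreviation "B \<equiv> tree_diagram enc T"

lemma nodes_B [simp]: "nodes B = enc ` subtrees T"
  by (simp add: tree_diagram_def)

lemma root_B [simp]: "root_node B = enc T"
  by (simp add: tree_diagram_def)

lemma label_Leaf [simp]: "Leaf A \<in> subtrees T \<Longrightarrow> node_label B (enc (Leaf A)) = Inr A"
  by (simp add: tree_diagram_def inj)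

lemma label_Node [simp]: "Node x l h \<in> subtrees T \<Longrightarrow> node_label B (enc (Node x l h)) = Inl x"
  by (simp add: tree_diagram_def inj)

lemma succ_Node [simp]:
  "Node x l h \<in> subtrees T \<Longrightarrow> succ B (enc (Node x l h)) b = enc (if b then h else l)"
  by (simp add: tree_diagram_def inj)

lemma enc_eq: "s \<in> subtrees T \<Longrightarrow> t \<in> subtrees T \<Longrightarrow> enc s = enc t \<longleftrightarrow> s = t"
  using inj by (auto dest: inj_onD)

lemma Node_decision_node: "Node x l h \<in> subtrees T \<Longrightarrow> enc (Node x l h) \<in> decision_nodes B"
  by (simp add: decision_nodes_def)

lemma decision_nodeE:
  assumes "n \<in> decision_nodes B"
  obtains x l h where "n = enc (Node x l h)" "Node x l h \<in> subtrees T"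
    "l \<in> subtrees T" "h \<in> subtrees T"
proof -
  obtain t where "t \<in> subtrees T" "n = enc t" "isl (node_label B n)"
    using assms by (auto simp: decision_nodes_def)
  then obtain x l h where "n = enc (Node x l h)" "Node x l h \<in> subtrees T"
    by (cases t) auto
  then show thesis
    using that Node_subtreesD by metis
qed

lemma action_nodeE:
  assumes "n \<in> action_nodes B"
  obtains A where "n = enc (Leaf A)" "Leaf A \<in> subtrees T"
proof -
  obtain t where "t \<in> subtrees T" "n = enc t" "\<not> isl (node_label B n)"
    using assms by (auto simp: action_nodes_def decision_nodes_def)
  then show thesis
    using that by (cases t) auto
qed

lemma decision_label_Node [simp]:
  "Node x l h \<in> subtrees T \<Longrightarrow> decision_label B (enc (Node x l h)) = x"
  by (simp add: decision_label_def)

lemma decision_labels_B: "decision_labels B \<subseteq> tree_labels T"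
  using tree_labels_subtree by (fastforce simp: decision_labels_def elim!: decision_nodeE)

text \<open>Every edge leads to a proper subtree, so the size of the decoded tree strictly decreases
  along it.\<close>

lemma acyclic_B: "acyclic (edges B)"
proof -
  let ?dec = "inv_into (subtrees T) enc"
  have "(edges B)\<inverse> \<subseteq> measure (size \<circ> ?dec)"
  proof
    fix e assume "e \<in> (edges B)\<inverse>"
    then obtain d b where e: "e = (succ B d b, d)" and d: "d \<in> decision_nodes B"
      by (auto simp: edges_def)
    from d show "e \<in> measure (size \<circ> ?dec)"
      by (rule decision_nodeE) (auto simp: e inj)
  qed
  then show ?thesis
    using wf_acyclic[OF wf_subset[OF wf_measure]] acyclic_converse by blast
qed

lemma diagram_B:
  assumes "tree_labels T \<subseteq> L" and "\<Union> (leaf_sets T) \<subseteq> Act"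
  shows "decision_diagram L Act B"
proof -
  have "action_label B n \<subseteq> Act" if "n \<in> action_nodes B" for n
    using that
  proof (rule action_nodeE)
    fix A assume "n = enc (Leaf A)" "Leaf A \<in> subtrees T"
    then show ?thesis
      using leaf_sets_subtree[of "Leaf A" T] assms(2) by (auto simp: action_label_def)
  qed
  moreover have "succ B d b \<in> nodes B" if "d \<in> decision_nodes B" for d b
    using that by (rule decision_nodeE) auto
  ultimately show ?thesis
    using decision_labels_B assms(1) acyclic_B by (auto simp: decision_diagram_def)
qed

text \<open>Used twice: with \<open>t = T\<close> it makes every node reachable from the root, and
  below it places all subtrees of a tree in the domain of an isomorphism of subdiagrams.\<close>

lemma reachable_subtree:
  "s \<in> subtrees t \<Longrightarrow> t \<in> subtrees T \<Longrightarrow> (enc t, enc s) \<in> (edges B)\<^sup>*"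
proof (induction t)
  case (Node x l h)
  have edge: "(enc (Node x l h), enc (if b then h else l)) \<in> edges B" for b
    using Node_decision_node[OF Node.prems(2)] Node.prems(2)
    by (auto simp: edges_def intro!: exI[of _ "enc (Node x l h)"] exI[of _ b])
  show ?case
    using Node edge[of True] edge[of False] Node_subtreesD[OF Node.prems(2)]
    by (auto intro: converse_rtrancl_into_rtrancl)
qed auto

lemma ordered_B:
  assumes "ordered_tree \<rho> T" and "tot_order X \<rho>" and "tree_labels T \<subseteq> X"
  shows "ordered_diagram X \<rho> B"
proof -
  have "\<rho> (decision_label B d) < \<rho> (decision_label B (succ B d b))"
    if "d \<in> decision_nodes B" "succ B d b \<in> decision_nodes B" for d b
    using that(1)
  proof (rule decision_nodeE)
    fix x l h
    assume d: "d = enc (Node x l h)" and T: "Node x l h \<in> subtrees T" "l \<in> subtrees T" "h \<in> subtrees T"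
    define s where "s = (if b then h else l)"
    have "enc s \<in> decision_nodes B" and s: "s \<in> subtrees T"
      using that(2) d T by (auto simp: s_def)
    \<comment> \<open>The successor is a decision node, so by injectivity of \<open>enc\<close> the
      subtree \<open>s\<close> is not a leaf.\<close>
    then obtain y l' h' where y: "s = Node y l' h'"
      by (auto elim!: decision_nodeE simp: enc_eq)
    have "\<rho> x < \<rho> y"
      using ordered_tree_subtree[OF assms(1) T(1)] y by (auto simp: s_def split: if_splits)
    then show ?thesis
      using d T(1) s y by (simp flip: s_def)
  qed
  then show ?thesis
    using assms(2,3) decision_labels_B by (auto simp: ordered_diagram_def)
qed

text \<open>A subdiagram determines the tree it unfolds to, and an isomorphism keeps labels and
  successors, hence that tree. Sharing is therefore maximal.\<close>

lemma isomorphic_subdiagramsD: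
  assumes s: "s \<in> subtrees T" and t: "t \<in> subtrees T"
    and iso: "isomorphic_diagrams (subdiagram B (enc s)) (subdiagram B (enc t))"
  shows "s = t"
proof -
  obtain f where f: "bij_betw f {m. (enc s, m) \<in> (edges B)\<^sup>*} {m. (enc t, m) \<in> (edges B)\<^sup>*}"
      "f (enc s) = enc t"
    and lab: "\<And>n. (enc s, n) \<in> (edges B)\<^sup>* \<Longrightarrow> node_label B (f n) = node_label B n"
    and suc: "\<And>n b. (enc s, n) \<in> (edges B)\<^sup>* \<Longrightarrow> isl (node_label B n) \<Longrightarrow>
                succ B (f n) b = f (succ B n b)"
    using iso by (auto simp: isomorphic_diagrams_def subdiagram_def decision_nodes_def)
  \<comment> \<open>Generalised from the roots to all corresponding nodes, for structural induction
    on \<open>u\<close>: equal labels give the same constructor, and commuting with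
    \<open>succ\<close> sends children to children.\<close>
  have "u = v" if "u \<in> subtrees s" "v \<in> subtrees T" "f (enc u) = enc v" for u v
    using that
  proof (induction u arbitrary: v)
    case (Leaf A)
    then have "node_label B (enc v) = Inr A"
      using lab[OF reachable_subtree[OF Leaf(1) s]] subtrees_trans[OF Leaf(1) s] by simp
    then show ?case
      using Leaf(2) by (cases v) auto
  next
    case (Node x l h)
    note u = subtrees_trans[OF Node.prems(1) s]
    have reach: "(enc s, enc (Node x l h)) \<in> (edges B)\<^sup>*"
      by (rule reachable_subtree[OF Node.prems(1) s])
    have "node_label B (enc v) = Inl x"
      using lab[OF reach] Node.prems(3) u by simp
    then obtain l' h' where v: "v = Node x l' h'"
      using Node.prems(2) by (cases v) auto
    have "enc (if b then h' else l') = f (enc (if b then h else l))" for b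
      using suc[OF reach, of b] Node.prems(2,3) u v by simp
    from this[of True] this[of False] show ?case
      using Node.IH Node_subtreesD[OF Node.prems(1)] Node_subtreesD[of x l' h' T] Node.prems(2) v
      by auto
  qed
  then show ?thesis
    using t f(2) by auto
qed

text \<open>Essential decisions come from \<open>reduced_tree\<close> through injectivity of
  \<open>enc\<close>; the absence of isomorphic subdiagrams is due to sharing alone.\<close>

lemma reduced_B:
  assumes "reduced_tree T"
  shows "reduced_diagram B"
proof -
  have "succ B d False \<noteq> succ B d True" if "d \<in> decision_nodes B" for d
    using that
    by (rule decision_nodeE) (use reduced_tree_subtree[OF assms] in \<open>fastforce simp: enc_eq\<close>)
  then show ?thesis
    using isomorphic_subdiagramsD by (auto simp: reduced_diagram_def)
qed

lemma BDD_B: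
  assumes "ordered_tree \<rho> T" and "reduced_tree T" and "\<Union> (leaf_sets T) \<subseteq> Act"
    and "tot_order X \<rho>" and "tree_labels T \<subseteq> X"
  shows "BDD X \<rho> Act B"
  using assms diagram_B ordered_B reduced_B reachable_subtree by (auto simp: BDD_def)

text \<open>Sharing creates no new sequence of tests and answers: a path in the graph still descends
  through the tree it unfolds to. The start is an arbitrary subtree so that the induction can move
  on to a child.\<close>

lemma path_branch:
  assumes "is_path B (ps, m)" and "m \<in> action_nodes B"
    and "path_nodes (ps, m) ! 0 = enc t" and "t \<in> subtrees T"
  shows "map (\<lambda>(d, b). (decision_label B d, b)) ps \<in> branches t"
  using assms
proof (induction ps arbitrary: t)
  case Nil
  then show ?case
    by (auto simp: path_nodes_def enc_eq elim!: action_nodeE)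
next
  case (Cons db ps)
  obtain d b where db: "db = (d, b)"
    by fastforce
  have step: "path_nodes (db # ps, m) ! Suc i = succ B (path_nodes (db # ps, m) ! i) (snd ((db # ps) ! i))"
    if "i < Suc (length ps)" for i
    using Cons.prems(1) that by (auto simp: is_path_def)
  \<comment> \<open>Dropping the first entry shifts positions by one, so step \<open>i\<close> of
    the tail is step \<open>Suc i\<close> of the whole path.\<close>
  have "is_path B (ps, m)"
    using Cons.prems(1) step[of "Suc i" for i] by (auto simp: is_path_def path_nodes_def)
  moreover have "d \<in> decision_nodes B"
    using Cons.prems(1) by (auto simp: is_path_def db)
  then obtain x l h where n: "d = enc (Node x l h)" "Node x l h \<in> subtrees T"
      "l \<in> subtrees T" "h \<in> subtrees T"
    by (rule decision_nodeE)
  moreover have "t = Node x l h"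
    using Cons.prems(3,4) n by (simp add: path_nodes_def db enc_eq)
  moreover have "path_nodes (ps, m) ! 0 = enc (if b then h else l)"
    using step[of 0] n by (simp add: path_nodes_def db)
  ultimately show ?case
    using Cons.IH[of "if b then h else l"] Cons.prems(2) by (auto simp: db split: if_splits)
qed

end


section \<open>Relabelling\<close>

lemma relabel_simps [simp]:
  "nodes (relabel \<gamma> P) = nodes P"
  "node_label (relabel \<gamma> P) n = map_sum \<gamma> id (node_label P n)"
  "succ (relabel \<gamma> P) = succ P"
  "root_node (relabel \<gamma> P) = root_node P"
  by (simp_all add: relabel_def)

lemma isl_map_sum [simp]: "isl (map_sum f g x) \<longleftrightarrow> isl x"
  by (cases x) auto

lemma decision_nodes_relabel [simp]: "decision_nodes (relabel \<gamma> P) = decision_nodes P"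
  by (simp add: decision_nodes_def)

lemma action_nodes_relabel [simp]: "action_nodes (relabel \<gamma> P) = action_nodes P"
  by (simp add: action_nodes_def)

lemma edges_relabel [simp]: "edges (relabel \<gamma> P) = edges P"
  by (simp add: edges_def)

lemma is_path_relabel [simp]: "is_path (relabel \<gamma> P) p \<longleftrightarrow> is_path P p"
  by (simp add: is_path_def)

text \<open>Restricted to decision nodes, since \<open>projl\<close> of an action label is
  unspecified and need not commute with \<gamma>.\<close>

lemma decision_label_relabel:
  "d \<in> decision_nodes P \<Longrightarrow> decision_label (relabel \<gamma> P) d = \<gamma> (decision_label P d)"
  by (cases "node_label P d") (auto simp: decision_nodes_def decision_label_def)

lemma action_label_relabel:
  "n \<in> action_nodes P \<Longrightarrow> action_label (relabel \<gamma> P) n = action_label P n"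
  by (cases "node_label P n") (auto simp: decision_nodes_def action_nodes_def action_label_def)

lemma decision_labels_relabel: "decision_labels (relabel \<gamma> P) = \<gamma> ` decision_labels P"
  by (auto simp: decision_labels_def decision_label_relabel image_image)

lemma decision_diagram_relabel:
  assumes "decision_diagram X Act P" and "\<gamma> ` X \<subseteq> L"
  shows "decision_diagram L Act (relabel \<gamma> P)"
  using assms by (auto simp: decision_diagram_def decision_labels_relabel action_label_relabel)

lemma ordered_diagram_relabel:
  assumes "ordered_diagram X (\<pi> \<circ> \<gamma>) P" and "\<gamma> ` X \<subseteq> L" and "tot_order L \<pi>"
  shows "ordered_diagram L \<pi> (relabel \<gamma> P)"
  using assms by (auto simp: ordered_diagram_def decision_labels_relabel decision_label_relabel)

lemma reachable_in_nodes:
  assumes "decision_diagram X Act P" and "n \<in> nodes P" and "(n, m) \<in> (edges P)\<^sup>*"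
  shows "m \<in> nodes P"
  using assms(3,2,1) by (induction rule: rtrancl_induct) (auto simp: edges_def decision_diagram_def)

text \<open>The same map \<open>f\<close> serves: all labels lie in \<open>X\<close>, where \<gamma>
  is injective, so labels that agree after relabelling agreed before.\<close>

lemma isomorphic_subdiagrams_relabelD:
  assumes P: "decision_diagram X Act P" and inj: "inj_on \<gamma> X" and n: "n \<in> nodes P" "n' \<in> nodes P"
    and iso: "isomorphic_diagrams (subdiagram (relabel \<gamma> P) n) (subdiagram (relabel \<gamma> P) n')"
  shows "isomorphic_diagrams (subdiagram P n) (subdiagram P n')"
proof -
  obtain f where f: "bij_betw f {m. (n, m) \<in> (edges P)\<^sup>*} {m. (n', m) \<in> (edges P)\<^sup>*}" "f n = n'"
    and lab: "\<And>m. (n, m) \<in> (edges P)\<^sup>* \<Longrightarrow>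
                map_sum \<gamma> id (node_label P (f m)) = map_sum \<gamma> id (node_label P m)"
    and suc: "\<And>m b. (n, m) \<in> (edges P)\<^sup>* \<Longrightarrow> isl (node_label P m) \<Longrightarrow>
                succ P (f m) b = f (succ P m b)"
    using iso by (auto simp: isomorphic_diagrams_def subdiagram_def decision_nodes_def)
  have label: "x \<in> X" if "m \<in> nodes P" "node_label P m = Inl x" for m x
  proof -
    have "decision_label P m \<in> decision_labels P"
      using that by (auto simp: decision_labels_def decision_nodes_def)
    then show ?thesis
      using P that by (auto simp: decision_diagram_def decision_label_def)
  qed
  have "node_label P (f m) = node_label P m" if m: "(n, m) \<in> (edges P)\<^sup>*" for m
  proof -
    \<comment> \<open>The image of \<open>m\<close> is reachable from \<open>n'\<close>, hence a
      node, so its label too lies in \<open>X\<close>.\<close>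
    have "f m \<in> nodes P" "m \<in> nodes P"
      using bij_betwE[OF f(1)] m n reachable_in_nodes[OF P] by auto
    then show ?thesis
      using lab[OF m] label inj_onD[OF inj]
      by (cases "node_label P m"; cases "node_label P (f m)") auto
  qed
  then show ?thesis
    using f suc by (auto simp: isomorphic_diagrams_def subdiagram_def decision_nodes_def)
qed

lemma reduced_diagram_relabel:
  assumes "decision_diagram X Act P" and "inj_on \<gamma> X" and "reduced_diagram P"
  shows "reduced_diagram (relabel \<gamma> P)"
proof -
  have "n = n'" if "n \<in> nodes P" "n' \<in> nodes P"
      "isomorphic_diagrams (subdiagram (relabel \<gamma> P) n) (subdiagram (relabel \<gamma> P) n')" for n n'
    using isomorphic_subdiagrams_relabelD[OF assms(1,2) that] assms(3) that(1,2)
    by (auto simp: reduced_diagram_def)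
  then show ?thesis
    using assms(3) by (auto simp: reduced_diagram_def)
qed

section \<open>Semantics and consistency of the relabelled shared diagram\<close>

context shared_tree
begin

lemma sem_relabel_B:
  "t \<in> subtrees T \<Longrightarrow>
   sem_node (relabel \<gamma> B) (enc t) \<epsilon> = tree_eval (\<lambda>x. satisfies \<epsilon> (\<gamma> x)) t"
proof (induction t)
  case (Leaf A)
  then show ?case
    by (simp add: sem_node.simps)
next
  case (Node x l h)
  then show ?case
    using Node_subtreesD[OF Node.prems] by (subst sem_node.simps) simp
qed

text \<open>Consistency with a path concerns only its labels and answers. By
  \<open>path_branch\<close> these form a branch of \<open>T\<close>, so realising each branch of
  the tree is enough.\<close>

lemma consistent_relabel_B:
  assumes "\<And>bs. bs \<in> branches T \<Longrightarrow>
             \<exists>\<epsilon> \<in> evaluations Var. \<forall>(x, b) \<in> set bs. satisfies \<epsilon> (\<gamma> x) \<longleftrightarrow> b"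
  shows "consistent_PDD Var (relabel \<gamma> B)"
  unfolding consistent_PDD_def
proof (intro allI impI, elim conjE)
  fix p
  assume path: "is_path (relabel \<gamma> B) p" and root: "path_nodes p ! 0 = root_node (relabel \<gamma> B)"
    and act: "snd p \<in> action_nodes (relabel \<gamma> B)"
  let ?bs = "map (\<lambda>(d, b). (decision_label B d, b)) (fst p)"
  have "?bs \<in> branches T"
    using path_branch[of "fst p" "snd p" T] path root act by simp
  then obtain \<epsilon> where \<epsilon>: "\<epsilon> \<in> evaluations Var"
      "\<forall>(x, b) \<in> set ?bs. satisfies \<epsilon> (\<gamma> x) \<longleftrightarrow> b"
    using assms by blast
  have "satisfies \<epsilon> (decision_label (relabel \<gamma> B) (path_nodes p ! i)) \<longleftrightarrow> snd (fst p ! i)"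
    if i: "i < length (fst p)" for i
  proof -
    have elem: "fst p ! i \<in> set (fst p)"
      using i by simp
    then have "fst (fst p ! i) \<in> decision_nodes B"
      using path by (auto simp: is_path_def)
    moreover have "path_nodes p ! i = fst (fst p ! i)"
      using i by (simp add: path_nodes_def nth_append)
    ultimately show ?thesis
      using \<epsilon>(2) elem by (auto simp: decision_label_relabel split_beta)
  qed
  then show "\<exists>\<epsilon> \<in> evaluations Var. path_consistent_with (relabel \<gamma> B) p \<epsilon>"
    using \<epsilon>(1) by (auto simp: path_consistent_with_def)
qed

end


section \<open>Semantics\<close>

text \<open>In a finite acyclic graph the converse of the edge relation is well-founded, which
  allows induction from the action nodes upwards.\<close>

lemma decision_diagram_induct [consumes 2, case_names action decision]:
  assumes P: "decision_diagram L Act P" and n: "n \<in> nodes P"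
    and action: "\<And>n. n \<in> action_nodes P \<Longrightarrow> Q n"
    and decision: "\<And>d. d \<in> decision_nodes P \<Longrightarrow> (\<And>b. Q (succ P d b)) \<Longrightarrow> Q d"
  shows "Q n"
proof -
  have "edges P \<subseteq> nodes P \<times> nodes P"
    using P by (auto simp: decision_diagram_def edges_def decision_nodes_def)
  then have "finite (edges P)"
    by (rule finite_subset) (use P in \<open>simp add: decision_diagram_def\<close>)
  then have "wf ((edges P)\<inverse>)"
    using P by (simp add: decision_diagram_def finite_acyclic_wf_converse)
  then show ?thesis
    using n
  proof (induction n rule: wf_induct_rule)
    case (less n)
    show ?case
    proof (cases "n \<in> decision_nodes P")
      case True
      then have "(n, succ P n b) \<in> edges P" "succ P n b \<in> nodes P" for b
        using P unfolding edges_def decision_diagram_def by blast+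
      then have "Q (succ P n b)" for b
        using less.IH by simp
      then show ?thesis
        using True decision by blast
    next
      case False
      then show ?thesis
        using less action by (auto simp: action_nodes_def)
    qed
  qed
qed

lemma sem_node_action: "n \<in> action_nodes P \<Longrightarrow> sem_node P n \<epsilon> = action_label P n"
  by (subst sem_node.simps)
    (cases "node_label P n"; auto simp: action_nodes_def decision_nodes_def action_label_def)

lemma sem_node_decision:
  "d \<in> decision_nodes P \<Longrightarrow>
   sem_node P d \<epsilon> = sem_node P (succ P d (satisfies \<epsilon> (decision_label P d))) \<epsilon>"
  by (subst sem_node.simps)
    (cases "node_label P d"; auto simp: decision_nodes_def decision_label_def)

text \<open>Bounds the values for every function \<epsilon>, also outside
  \<open>evaluations Var\<close>; the leaves built later carry such values.\<close>

lemma sem_node_subset: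
  assumes "decision_diagram L Act P" and "n \<in> nodes P"
  shows "sem_node P n \<epsilon> \<subseteq> Act"
  using assms
proof (induction rule: decision_diagram_induct)
  case (action n)
  then show ?case
    using assms(1) by (simp add: sem_node_action decision_diagram_def)
qed (simp add: sem_node_decision)

text \<open>Once the truth values of all predicates of \<open>P\<close> are fixed, so is the result.
  This makes the leaves of the tree below independent of the chosen evaluation.\<close>

lemma sem_node_cong:
  assumes "decision_diagram L Act P" and "n \<in> nodes P"
    and eq: "\<And>p. p \<in> decision_labels P \<Longrightarrow> satisfies \<epsilon> p \<longleftrightarrow> satisfies \<epsilon>' p"
  shows "sem_node P n \<epsilon> = sem_node P n \<epsilon>'"
  using assms(1,2)
proof (induction rule: decision_diagram_induct)
  case (decision d)
  then show ?case
    using eq[of "decision_label P d"] by (simp add: sem_node_decision decision_labels_def)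
qed (simp add: sem_node_action)


section \<open>The reduced consistent decision tree\<close>

text \<open>Here \<open>f\<close> is the function to represent and \<open>q x e\<close> the answer
  of \<open>e\<close> to the test \<open>x\<close>. At the end of the list any element of
  \<open>E\<close> may represent it, provided the tests determine \<open>f\<close> on
  \<open>E\<close>. Both recursive trees are formed even for an empty half; for nonempty
  \<open>E\<close> that one is discarded.\<close>

primrec build_tree ::
  "('e \<Rightarrow> 'a set) \<Rightarrow> ('l \<Rightarrow> 'e \<Rightarrow> bool) \<Rightarrow> 'l list \<Rightarrow> 'e set \<Rightarrow> ('l, 'a) dtree" where
  "build_tree f q [] E = Leaf (f (SOME e. e \<in> E))"
| "build_tree f q (x # xs) E =
     (let E0 = {e \<in> E. \<not> q x e}; E1 = {e \<in> E. q x e};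
          l = build_tree f q xs E0; h = build_tree f q xs E1
      in if E0 = {} then h else if E1 = {} \<or> l = h then l else Node x l h)"

lemma reduced_build_tree: "reduced_tree (build_tree f q xs E)"
  by (induction xs arbitrary: E) (auto simp: Let_def)

lemma labels_build_tree: "tree_labels (build_tree f q xs E) \<subseteq> set xs"
  by (induction xs arbitrary: E) (simp_all add: Let_def subset_insertI2)

lemma ordered_build_tree:
  "sorted_wrt (\<lambda>x y. \<rho> x < \<rho> y) xs \<Longrightarrow> ordered_tree \<rho> (build_tree f q xs E)"
proof (induction xs arbitrary: E)
  case (Cons x xs)
  have "\<rho> x < \<rho> y" if "y \<in> tree_labels (build_tree f q xs E')" for y E'
    using Cons.prems labels_build_tree that by fastforce
  then show ?case
    using Cons by (auto simp: Let_def)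
qed simp

text \<open>The bound is the whole range of \<open>f\<close>, not the image of \<open>E\<close>,
  because for empty \<open>E\<close> the choice in the leaf is arbitrary.\<close>

lemma leaf_sets_build_tree: "leaf_sets (build_tree f q xs E) \<subseteq> range f"
  by (induction xs arbitrary: E) (simp_all add: Let_def)

text \<open>A test is kept only if both halves are nonempty, so nonemptiness passes down every
  branch, and whatever remains of \<open>E\<close> at the leaf gives the same answers as the
  branch.\<close>

lemma build_tree_branch:
  "E \<noteq> {} \<Longrightarrow> bs \<in> branches (build_tree f q xs E) \<Longrightarrow> \<exists>e \<in> E. \<forall>(x, b) \<in> set bs. q x e \<longleftrightarrow> b"
proof (induction xs arbitrary: E bs)
  case (Cons x xs)
  define E0 E1 where E: "E0 = {e \<in> E. \<not> q x e}" "E1 = {e \<in> E. q x e}"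
  let ?l = "build_tree f q xs E0" and ?h = "build_tree f q xs E1"
  have branch: "bs \<in> branches (if E0 = {} then ?h else if E1 = {} \<or> ?l = ?h then ?l else Node x ?l ?h)"
    using Cons.prems(2) unfolding E build_tree.simps Let_def .
  show ?case
  proof (cases "E0 = {} \<or> E1 = {} \<or> ?l = ?h")
    case True
    \<comment> \<open>The test is dropped, and the tree returned is the one for \<open>E'\<close>.
      This set is nonempty because the halves cover \<open>E\<close>.\<close>
    define E' where "E' = (if E0 = {} then E1 else E0)"
    have "E' \<noteq> {}" "E' \<subseteq> E"
      using Cons.prems(1) by (auto simp: E E'_def)
    moreover have "bs \<in> branches (build_tree f q xs E')"
      using branch True by (auto simp: E'_def split: if_splits)
    ultimately show ?thesis
      using Cons.IH by (meson subsetD)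
  next
    case False
    then have "bs \<in> (#) (x, False) ` branches ?l \<union> (#) (x, True) ` branches ?h"
      using branch by simp
    \<comment> \<open>Indexing the halves by the answer \<open>b\<close> lets one use of the
      induction hypothesis cover both children.\<close>
    then have "\<exists>b. bs \<in> (#) (x, b) ` branches (build_tree f q xs (if b then E1 else E0))"
      unfolding ex_bool_eq by auto
    then obtain b cs where bs: "bs = (x, b) # cs"
        and cs: "cs \<in> branches (build_tree f q xs (if b then E1 else E0))"
      by (elim exE imageE)
    have "(if b then E1 else E0) \<noteq> {}"
      using False by simp
    from Cons.IH[OF this cs] obtain e
      where "e \<in> (if b then E1 else E0)" "\<forall>(x, b) \<in> set cs. q x e \<longleftrightarrow> b" ..
    with bs show ?thesis
      by (auto simp: E split: if_splits)
  qed
qed auto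

text \<open>On a half of \<open>E\<close> all answers to \<open>x\<close> agree, so if
  \<open>x # xs\<close> determines \<open>f\<close> on \<open>E\<close>, then \<open>xs\<close>
  determines it on the half. At the leaf \<open>f\<close> is constant on the remaining set.\<close>

lemma build_tree_eval:
  assumes "\<And>e e'. e \<in> E \<Longrightarrow> e' \<in> E \<Longrightarrow> (\<And>x. x \<in> set xs \<Longrightarrow> q x e \<longleftrightarrow> q x e') \<Longrightarrow> f e = f e'"
    and "e \<in> E"
  shows "tree_eval (\<lambda>x. q x e) (build_tree f q xs E) = f e"
  using assms
proof (induction xs arbitrary: E)
  case Nil
  have "(SOME e. e \<in> E) \<in> E"
    using Nil.prems(2) by (rule someI)
  then have "f (SOME e. e \<in> E) = f e"
    by (rule Nil.prems(1)) (use Nil.prems(2) in auto)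
  then show ?case
    by simp
next
  case (Cons x xs)
  have IH: "tree_eval (\<lambda>x. q x e) (build_tree f q xs {e' \<in> E. q x e' \<longleftrightarrow> b}) = f e" if "q x e \<longleftrightarrow> b" for b
  proof (rule Cons.IH)
    show "f e1 = f e2" if "e1 \<in> {e' \<in> E. q x e' \<longleftrightarrow> b}" "e2 \<in> {e' \<in> E. q x e' \<longleftrightarrow> b}"
      "\<And>y. y \<in> set xs \<Longrightarrow> q y e1 \<longleftrightarrow> q y e2" for e1 e2
      by (rule Cons.prems(1)) (use that in auto)
  qed (use Cons.prems(2) that in simp)
  \<comment> \<open>The half containing \<open>e\<close> is nonempty, so a skipped test leaves the
    tree of that half, or one equal to it.\<close>
  show ?case
    using IH[of True] IH[of False] Cons.prems(2) by (cases "q x e") (auto simp: Let_def)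
qed

section \<open>Construction of the equivalent diagram and its BDD\<close>

lemma evaluations_nonempty: "evaluations Var \<noteq> {}"
  by (simp add: evaluations_def PiE_eq_empty_iff)

theorem theorem4p6:
  fixes Var :: "'v set" and Act :: "'a set"
    and P :: "('n, ('v, 'd::linorder) predicate, 'a) diagram"
    and \<pi> :: "('v, 'd) predicate \<Rightarrow> nat"
  assumes "PDD Var Act P"
    and "tot_order (decision_labels P) \<pi>"
  shows "\<exists>P' :: (nat, ('v, 'd) predicate, 'a) diagram.
           PDD Var Act P' \<and>
           consistent_PDD Var P' \<and>
           reduced_diagram P' \<and>
           ordered_diagram (decision_labels P) \<pi> P' \<and>
           (\<forall>\<epsilon> \<in> evaluations Var. sem P' \<epsilon> = sem P \<epsilon>) \<and>
           (\<exists>(PVar :: nat set) (\<gamma> :: nat \<Rightarrow> ('v, 'd) predicate) (B :: (nat, nat, 'a) diagram).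
              bij_betw \<gamma> PVar (decision_labels P) \<and>
              BDD PVar (\<pi> \<circ> \<gamma>) Act B \<and>
              predicate_consistent Var \<gamma> B \<and>
              P' = relabel \<gamma> B)"
proof -
  let ?L = "decision_labels P"
  \<comment> \<open>The Boolean variables are the positions of the predicates in the order \<pi>,
    and \<gamma> recovers the predicate from its position. Thus
    \<open>\<pi> \<circ> \<gamma>\<close> is the identity on \<open>X\<close>, and the required
    order is that of the numbers.\<close>
  define X where "X = {1..card ?L}"
  define \<gamma> where "\<gamma> = inv_into ?L \<pi>"
  \<comment> \<open>Positions start at 1, and the upper end of the list is excluded, hence the
    \<open>Suc\<close>.\<close>
  define T where "T = build_tree (sem P) (\<lambda>x \<epsilon>. satisfies \<epsilon> (\<gamma> x)) [1..<Suc (card ?L)] (evaluations Var)"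
  have P: "decision_diagram (predicates Var) Act P"
    using assms(1) by (simp add: PDD_def)
  then have root: "root_node P \<in> nodes P" and L: "?L \<subseteq> predicates Var"
    by (auto simp: decision_diagram_def)
  have \<pi>: "bij_betw \<pi> ?L X"
    using assms(2) by (simp add: tot_order_def X_def)
  then have \<gamma>: "bij_betw \<gamma> X ?L"
    unfolding \<gamma>_def by (rule bij_betw_inv_into)
  then have \<gamma>_image: "\<gamma> ` X = ?L" and \<gamma>_inj: "inj_on \<gamma> X"
    by (simp_all add: bij_betw_def)
  have \<pi>\<gamma>: "(\<pi> \<circ> \<gamma>) x = x" if "x \<in> X" for x
    using bij_betw_inv_into_right[OF \<pi> that] by (simp add: \<gamma>_def)
  have set_X: "set [1..<Suc (card ?L)] = X"
    by (auto simp: X_def)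
  have "bij_betw (\<pi> \<circ> \<gamma>) X X"
    using bij_betw_cong[of X "\<pi> \<circ> \<gamma>" id X] \<pi>\<gamma> by simp
  then have tot: "tot_order X (\<pi> \<circ> \<gamma>)"
    by (simp add: tot_order_def X_def)
  have sorted: "sorted_wrt (\<lambda>x y. (\<pi> \<circ> \<gamma>) x < (\<pi> \<circ> \<gamma>) y) [1..<Suc (card ?L)]"
    by (rule sorted_wrt_mono_rel[OF _ sorted_wrt_upt]) (use \<pi>\<gamma> set_X in metis)
  have labels: "tree_labels T \<subseteq> X"
    unfolding T_def set_X[symmetric] by (rule labels_build_tree)
  have "leaf_sets T \<subseteq> range (sem P)"
    unfolding T_def by (rule leaf_sets_build_tree)
  then have leaves: "\<Union> (leaf_sets T) \<subseteq> Act"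
    using sem_node_subset[OF P root] by (force simp: sem_def)
  have ordered: "ordered_tree (\<pi> \<circ> \<gamma>) T" and reduced: "reduced_tree T"
    unfolding T_def by (rule ordered_build_tree[OF sorted], rule reduced_build_tree)
  have eval: "tree_eval (\<lambda>x. satisfies \<epsilon> (\<gamma> x)) T = sem P \<epsilon>" if "\<epsilon> \<in> evaluations Var" for \<epsilon>
    unfolding T_def
  proof (rule build_tree_eval)
    \<comment> \<open>As \<gamma> maps \<open>X\<close> onto the labels of \<open>P\<close>,
      agreement on all tests is agreement on all predicates of \<open>P\<close>.\<close>
    fix e e' assume "\<And>x. x \<in> set [1..<Suc (card ?L)] \<Longrightarrow> satisfies e (\<gamma> x) \<longleftrightarrow> satisfies e' (\<gamma> x)"
    then show "sem P e = sem P e'"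
      unfolding sem_def set_X
      by (intro sem_node_cong[OF P root]) (auto simp flip: \<gamma>_image)
  qed (rule that)
  obtain enc :: "(nat, 'a) dtree \<Rightarrow> nat" where "inj_on enc (subtrees T)"
    using finite_imp_inj_to_nat_seg[OF finite_subtrees] by blast
  then interpret shared_tree enc T
    by unfold_locales
  have BDD: "BDD X (\<pi> \<circ> \<gamma>) Act B"
    by (rule BDD_B) fact+
  then have B: "decision_diagram X Act B" "ordered_diagram X (\<pi> \<circ> \<gamma>) B" "reduced_diagram B"
    by (simp_all add: BDD_def)
  \<comment> \<open>The construction starts from all evaluations, a nonempty set, so every branch of
    \<open>T\<close> is realised by one of them.\<close>
  have consistent: "consistent_PDD Var (relabel \<gamma> B)"
    by (rule consistent_relabel_B)
      (use build_tree_branch[OF evaluations_nonempty] in \<open>unfold T_def, blast\<close>)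
  show ?thesis
  proof (intro exI conjI ballI)
    show "PDD Var Act (relabel \<gamma> B)"
      unfolding PDD_def using B(1) \<gamma>_image L by (intro decision_diagram_relabel) auto
    show "ordered_diagram ?L \<pi> (relabel \<gamma> B)"
      using B(2) \<gamma>_image assms(2) by (intro ordered_diagram_relabel) auto
    show "reduced_diagram (relabel \<gamma> B)"
      using B(1) \<gamma>_inj B(3) by (rule reduced_diagram_relabel)
    show "sem (relabel \<gamma> B) \<epsilon> = sem P \<epsilon>" if "\<epsilon> \<in> evaluations Var" for \<epsilon>
      using eval[OF that] by (simp add: sem_def sem_relabel_B)
    show "predicate_consistent Var \<gamma> B"
      using consistent by (simp add: predicate_consistent_def)
  qed (fact \<gamma> BDD consistent refl)+
qed

end
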